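(* Let $N\ge 3$ be an odd integer, and assume the hypotheses (A), (B) and (C) described in the context hold for this $N$. Let $|\Psi(\alpha)\rangle$ be the polynomial eigenvector, with even number of up spins, described in the context. Then, as an identity of rational functions of $\alpha$, $$\Xi(\alpha) = \frac{\sum_{\mu, \mu_3, \ldots, \mu_N} \Psi_{\mu \bar\mu \mu_3 \ldots \mu_N}(\alpha)}{\sum_{\mu, \mu_3, \ldots, \mu_N} \Psi_{\mu \mu \mu_3 \ldots \mu_N}(\alpha)} = \frac{2}{\alpha + 1},$$ where all sums run over $\mu,\mu_3,\ldots,\mu_N\in\{+1,-1\}$ and $\bar\mu=-\mu$.
   Context: Spin chain. On $(\mathbb C^2)^{\otimes N}$ with periodic indices ($N+1\equiv 1$) and Pauli matrices $\sigma^x_j,\sigma^y_j,\sigma^z_j$ acting on the $j$-th factor, let $$\mathcal H(\alpha) = -\frac12\sum_{j=1}^N\left[(1+\alpha)\sigma^x_j\sigma^x_{j+1}+(1-\alpha)\sigma^y_j\sigma^y_{j+1}+\frac{\alpha^2-1}{2}\sigma^z_j\sigma^z_{j+1}\right],\qquad E(\alpha) = -\frac N4(3+\alpha^2).$$ The basis vectors $|\mu_1\ldots\mu_N\rangle$, $\mu_j=\pm1$ (also written $\pm$), satisfy $\sigma^z_j|\mu_1\ldots\mu_N\rangle=\mu_j|\mu_1\ldots\mu_N\rangle$; the $j$-th spin is up if $\mu_j=+1$. The Hamiltonian $\mathcal H(\alpha)$ preserves the parity of the number of up spins and commutes with $\sigma^x_1\cdots\sigma^x_N$. Hypothesis (A):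 for every real $\alpha$ the lowest eigenvalue of $\mathcal H(\alpha)$ equals $E(\alpha)$ and has multiplicity exactly two. (Since $N$ is odd, there is then exactly one eigenvector up to scale in each of the two sectors of even and of odd number of up spins.) Let $|\Psi(\alpha)\rangle=\sum\Psi_{\mu_1\ldots\mu_N}(\alpha)|\mu_1\ldots\mu_N\rangle$ denote the eigenvector, $\mathcal H(\alpha)|\Psi(\alpha)\rangle=E(\alpha)|\Psi(\alpha)\rangle$, lying in the sector with even number of up spins (components with an odd number of up spins are zero), normalized so that all its components are polynomials in $\alpha$ with integer coefficients and without non-constant common polynomial factor. Hypothesis (B): the normalization can be chosen (and is chosen) so that $\Psi_{--\cdots-}(\alpha)$ is a monic polynomial of degree $D_N=(N^2-1)/8$. Eight-vertex model. For a modulus $k\in(0,1)$ let $K$ be the complete elliptic integral of the first kind, let $\mathrm{sn}$ be the Jacobi elliptic function, and let $H(v)=\theta_1(\pi v/2K,q)$ and $\Theta(v)=\theta_4(\pi v/2K,q)$ be the Jacobi theta functions with nome $q=e^{-\pi K'/K}$ (so $\mathrm{sn}(v)=k^{-1/2}H(v)/\Theta(v)$). For a constant $\rho\ne0$ and a parameter $\eta$ put $$a(v)=\rho\,\Theta(2\eta)\Theta(v-\eta)H(v+\eta),\quad b(v)=\rho\,\Theta(2\eta)H(v-\eta)\Theta(v+\eta),$$ $$c(v)=\rho\,H(2\eta)\Theta(v-\eta)\Theta(v+\eta),\quad d(v)=\rho\,H(2\eta)H(v-\eta)H(v+\eta).$$ Let $R(v)$ be the operator on $\mathbb C^2\otimes\mathbb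 C^2$ with $R(v)|\mu\mu\rangle=a(v)|\mu\mu\rangle+d(v)|\bar\mu\bar\mu\rangle$ and $R(v)|\mu\bar\mu\rangle=b(v)|\mu\bar\mu\rangle+c(v)|\bar\mu\mu\rangle$. The inhomogeneous transfer-matrix with periodic boundary conditions is $$\mathcal T(v|v_1,\ldots,v_N)=\mathrm{tr}_0\left[R_{01}(v-v_1)R_{02}(v-v_2)\cdots R_{0N}(v-v_N)\right]$$ acting on $(\mathbb C^2)^{\otimes N}$, where $0$ labels an auxiliary copy of $\mathbb C^2$. Transfer-matrices with the same $v_1,\ldots,v_N$ and different $v$ commute. Hypothesis (C): for every $k\in(0,1)$, $\eta\in\{\pm 2K/3,\pm4K/3\}$ and all $v_1,\ldots,v_N$ there is a nonzero vector $|\Psi(v_1,\ldots,v_N)\rangle$, independent of $v$, such that for all $v$ $$\mathcal T(v|v_1,\ldots,v_N)|\Psi(v_1,\ldots,v_N)\rangle=\prod_{j=1}^N[a(v-v_j)+b(v-v_j)]\;|\Psi(v_1,\ldots,v_N)\rangle.$$ The relation between the parameter of the chain and that of the vertex model is $\alpha=k\,\mathrm{sn}^2(2\eta)$. *)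

theory Defs
  imports
    "HOL-Analysis.Analysis"
    "HOL-Computational_Algebra.Computational_Algebra"
    "HOL-Library.Function_Algebras"
begin

section \<open>Spin configurations and operators on the chain\<close>

text \<open>
  A spin is a boolean, \<^term>\<open>True\<close> being up ($+1$) and \<^term>\<open>False\<close> being down ($-1$).
  A basis vector of $(C^2)^{\otimes n}$ is a boolean list of length $n$, and a vector is the function
  giving its components; it vanishes on lists of any other length.  List positions start at 0.
\<close>

type_synonym state = "bool list \<Rightarrow> complex"

definition state_space :: "nat \<Rightarrow> state set" where
  "state_space n = {\<psi>. \<forall>\<mu>. length \<mu> \<noteq> n \<longrightarrow> \<psi> \<mu> = 0}"

global_interpretation state: vector_space "\<lambda>(c::complex) (\<psi>::state) \<mu>. c * \<psi> \<mu>"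
  by standard (auto simp: fun_eq_iff algebra_simps)

text \<open>
  The $2 \times 2$ matrix \<open>A r s\<close> (row \<open>r\<close>, column \<open>s\<close>) acting on the \<open>j\<close>-th factor, and the
  $4 \times 4$ matrix \<open>R (r\<^sub>1, r\<^sub>2) (s\<^sub>1, s\<^sub>2)\<close> acting on the factors \<open>i \<noteq> j\<close>.
\<close>

definition one_site_op :: "(bool \<Rightarrow> bool \<Rightarrow> complex) \<Rightarrow> nat \<Rightarrow> state \<Rightarrow> state" where
  "one_site_op A j \<psi> = (\<lambda>\<mu>. \<Sum>s\<in>UNIV. A (\<mu> ! j) s * \<psi> (\<mu>[j := s]))"

definition two_site_op ::
    "(bool \<times> bool \<Rightarrow> bool \<times> bool \<Rightarrow> complex) \<Rightarrow> nat \<Rightarrow> nat \<Rightarrow> state \<Rightarrow> state" where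
  "two_site_op R i j \<psi> =
     (\<lambda>\<mu>. \<Sum>(s, t)\<in>UNIV. R (\<mu> ! i, \<mu> ! j) (s, t) * \<psi> (\<mu>[i := s, j := t]))"

definition pauli_x :: "bool \<Rightarrow> bool \<Rightarrow> complex" where
  "pauli_x r s = (if r \<noteq> s then 1 else 0)"

definition pauli_y :: "bool \<Rightarrow> bool \<Rightarrow> complex" where
  "pauli_y r s = (if r = s then 0 else if r then - \<i> else \<i>)"

definition pauli_z :: "bool \<Rightarrow> bool \<Rightarrow> complex" where
  "pauli_z r s = (if r \<noteq> s then 0 else if r then 1 else - 1)"


section \<open>The XYZ spin chain\<close>

definition xyz_hamiltonian :: "nat \<Rightarrow> real \<Rightarrow> state \<Rightarrow> state" where
  "xyz_hamiltonian N \<alpha> \<psi> = (\<lambda>\<mu>. - (1 / 2) * (\<Sum>j<N. let j' = (j + 1) mod N in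
       of_real (1 + \<alpha>) * one_site_op pauli_x j (one_site_op pauli_x j' \<psi>) \<mu>
     + of_real (1 - \<alpha>) * one_site_op pauli_y j (one_site_op pauli_y j' \<psi>) \<mu>
     + of_real ((\<alpha>\<^sup>2 - 1) / 2) * one_site_op pauli_z j (one_site_op pauli_z j' \<psi>) \<mu>))"

definition ground_energy :: "nat \<Rightarrow> real \<Rightarrow> real" where
  "ground_energy N \<alpha> = - (real N / 4) * (3 + \<alpha>\<^sup>2)"

definition xyz_eigenspace :: "nat \<Rightarrow> real \<Rightarrow> complex \<Rightarrow> state set" where
  "xyz_eigenspace N \<alpha> E =
     {\<psi> \<in> state_space N. xyz_hamiltonian N \<alpha> \<psi> = (\<lambda>\<mu>. E * \<psi> \<mu>)}"

definition xyz_eigenvalue :: "nat \<Rightarrow> real \<Rightarrow> complex \<Rightarrow> bool" where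
  "xyz_eigenvalue N \<alpha> E \<longleftrightarrow> (\<exists>\<psi>\<in>xyz_eigenspace N \<alpha> E. \<psi> \<noteq> 0)"

text \<open>
  The Hamiltonian is Hermitian, so that only real eigenvalues have to be compared, and the
  multiplicity of an eigenvalue is the dimension of its eigenspace.
\<close>

definition hypothesis_A :: "nat \<Rightarrow> bool" where
  "hypothesis_A N \<longleftrightarrow> (\<forall>\<alpha>::real.
     xyz_eigenvalue N \<alpha> (of_real (ground_energy N \<alpha>)) \<and>
     (\<forall>E::real. xyz_eigenvalue N \<alpha> (of_real E) \<longrightarrow> ground_energy N \<alpha> \<le> E) \<and>
     state.dim (xyz_eigenspace N \<alpha> (of_real (ground_energy N \<alpha>))) = 2)"

definition eval_state :: "(bool list \<Rightarrow> int poly) \<Rightarrow> real \<Rightarrow> state" where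
  "eval_state \<Psi> \<alpha> = (\<lambda>\<mu>. poly (map_poly of_int (\<Psi> \<mu>)) (of_real \<alpha>))"

definition polynomial_ground_state :: "nat \<Rightarrow> (bool list \<Rightarrow> int poly) \<Rightarrow> bool" where
  "polynomial_ground_state N \<Psi> \<longleftrightarrow>
     (\<forall>\<mu>. length \<mu> \<noteq> N \<longrightarrow> \<Psi> \<mu> = 0) \<and>
     (\<forall>\<alpha>. eval_state \<Psi> \<alpha> \<in> xyz_eigenspace N \<alpha> (of_real (ground_energy N \<alpha>))) \<and>
     (\<forall>\<mu>. odd (count_list \<mu> True) \<longrightarrow> \<Psi> \<mu> = 0) \<and>
     (\<forall>p. (\<forall>\<mu>. p dvd \<Psi> \<mu>) \<longrightarrow> degree p = 0)"

definition hypothesis_B :: "nat \<Rightarrow> (bool list \<Rightarrow> int poly) \<Rightarrow> bool" where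
  "hypothesis_B N \<Psi> \<longleftrightarrow>
     lead_coeff (\<Psi> (replicate N False)) = 1 \<and>
     degree (\<Psi> (replicate N False)) = (N\<^sup>2 - 1) div 8"


section \<open>The inhomogeneous eight-vertex model\<close>

definition ellipK :: "real \<Rightarrow> real" where
  "ellipK k = integral {0..pi / 2} (\<lambda>t. 1 / sqrt (1 - k\<^sup>2 * (sin t)\<^sup>2))"

definition nome :: "real \<Rightarrow> real" where
  "nome k = exp (- pi * ellipK (sqrt (1 - k\<^sup>2)) / ellipK k)"

definition theta1 :: "complex \<Rightarrow> real \<Rightarrow> complex" where
  "theta1 z q = 2 * (\<Sum>n. (- 1) ^ n * of_real (q powr (real n + 1 / 2)\<^sup>2) * sin (of_nat (2 * n + 1) * z))"

definition theta4 :: "complex \<Rightarrow> real \<Rightarrow> complex" where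
  "theta4 z q = 1 + 2 * (\<Sum>n. (- 1) ^ Suc n * of_real (q ^ (Suc n)\<^sup>2) * cos (of_nat (2 * Suc n) * z))"

definition jacobi_H :: "real \<Rightarrow> complex \<Rightarrow> complex" where
  "jacobi_H k v = theta1 (of_real pi * v / (2 * of_real (ellipK k))) (nome k)"

definition jacobi_Theta :: "real \<Rightarrow> complex \<Rightarrow> complex" where
  "jacobi_Theta k v = theta4 (of_real pi * v / (2 * of_real (ellipK k))) (nome k)"

context
  fixes k :: real and \<rho> \<eta> :: complex
begin

definition weight_a :: "complex \<Rightarrow> complex" where
  "weight_a v = \<rho> * jacobi_Theta k (2 * \<eta>) * jacobi_Theta k (v - \<eta>) * jacobi_H k (v + \<eta>)"

definition weight_b :: "complex \<Rightarrow> complex" where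
  "weight_b v = \<rho> * jacobi_Theta k (2 * \<eta>) * jacobi_H k (v - \<eta>) * jacobi_Theta k (v + \<eta>)"

definition weight_c :: "complex \<Rightarrow> complex" where
  "weight_c v = \<rho> * jacobi_H k (2 * \<eta>) * jacobi_Theta k (v - \<eta>) * jacobi_Theta k (v + \<eta>)"

definition weight_d :: "complex \<Rightarrow> complex" where
  "weight_d v = \<rho> * jacobi_H k (2 * \<eta>) * jacobi_H k (v - \<eta>) * jacobi_H k (v + \<eta>)"

definition R_matrix :: "complex \<Rightarrow> bool \<times> bool \<Rightarrow> bool \<times> bool \<Rightarrow> complex" where
  "R_matrix v = (\<lambda>r (s, t).
     if s = t then
       (if r = (s, t) then weight_a v else if r = (\<not> s, \<not> t) then weight_d v else 0)
     else
       (if r = (s, t) then weight_b v else if r = (t, s) then weight_c v else 0))"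

text \<open>
  The auxiliary spin is put in front of the chain, at position 0, so that the spins of the chain
  are at the positions \<open>1, \<dots>, N\<close>; \<open>w j\<close> is the inhomogeneity of the \<open>j\<close>-th one.
\<close>

definition monodromy :: "nat \<Rightarrow> (nat \<Rightarrow> complex) \<Rightarrow> complex \<Rightarrow> state \<Rightarrow> state" where
  "monodromy N w v = foldr (\<lambda>j M. two_site_op (R_matrix (v - w j)) 0 j \<circ> M) [1..<N + 1] id"

definition transfer_matrix :: "nat \<Rightarrow> (nat \<Rightarrow> complex) \<Rightarrow> complex \<Rightarrow> state \<Rightarrow> state" where
  "transfer_matrix N w v \<psi> =
     (\<lambda>\<mu>. \<Sum>s\<in>UNIV. monodromy N w v
        (\<lambda>\<nu>. if \<nu> \<noteq> [] \<and> hd \<nu> = s then \<psi> (tl \<nu>) else 0) (s # \<mu>))"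

end

definition hypothesis_C :: "nat \<Rightarrow> complex \<Rightarrow> bool" where
  "hypothesis_C N \<rho> \<longleftrightarrow>
     (\<forall>k \<eta>. \<forall>w :: nat \<Rightarrow> complex. 0 < k \<and> k < 1 \<and>
        \<eta> \<in> {2 * ellipK k / 3, - (2 * ellipK k / 3), 4 * ellipK k / 3, - (4 * ellipK k / 3)} \<longrightarrow>
        (\<exists>\<Phi>\<in>state_space N. \<Phi> \<noteq> 0 \<and>
           (\<forall>v. transfer_matrix k \<rho> (of_real \<eta>) N w v \<Phi> =
              (\<lambda>\<mu>. (\<Prod>j=1..N. weight_a k \<rho> (of_real \<eta>) (v - w j) + weight_b k \<rho> (of_real \<eta>) (v - w j))
                 * \<Phi> \<mu>))))"


section \<open>The ratio\<close>

definition Xi_numerator :: "nat \<Rightarrow> (bool list \<Rightarrow> int poly) \<Rightarrow> int poly" where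
  "Xi_numerator N \<Psi> = (\<Sum>m\<in>UNIV. \<Sum>\<nu> | length \<nu> = N - 2. \<Psi> (m # (\<not> m) # \<nu>))"

definition Xi_denominator :: "nat \<Rightarrow> (bool list \<Rightarrow> int poly) \<Rightarrow> int poly" where
  "Xi_denominator N \<Psi> = (\<Sum>m\<in>UNIV. \<Sum>\<nu> | length \<nu> = N - 2. \<Psi> (m # m # \<nu>))"

definition Xi :: "nat \<Rightarrow> (bool list \<Rightarrow> int poly) \<Rightarrow> int poly fract" where
  "Xi N \<Psi> = Fract (Xi_numerator N \<Psi>) (Xi_denominator N \<Psi>)"

end

theory Submission
  imports Defs
begin

text \<open>
  Pair the eigenvalue equation with the sum of all basis vectors.  The spin flips occurring in
  \<open>H(\<alpha>)\<close> merely permute the components and preserve whether two neighbouring spins agree, so the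
  bond \<open>j\<close> contributes a combination of the sum of the components with \<open>\<mu>\<^sub>j = \<mu>\<^sub>j\<^sub>+\<^sub>1\<close> and the sum
  of those with \<open>\<mu>\<^sub>j \<noteq> \<mu>\<^sub>j\<^sub>+\<^sub>1\<close>.  By translation invariance neither sum depends on \<open>j\<close>, and the
  equation becomes \<open>(\<alpha> - 1) ((\<alpha> + 1) P - 2 Q) = 0\<close> for the numerator \<open>P\<close> and the denominator \<open>Q\<close>
  of \<open>\<Xi>\<close>.

  The translation invariance holds because the eigenvector is unique in its sector: for odd \<open>N\<close> the
  global spin flip exchanges the two sectors of the two-dimensional eigenspace.  So translation acts
  by a scalar, which is 1 because the component with all spins down is fixed and nonzero.
  By the same uniqueness the eigenvector at \<open>\<alpha> = 1\<close> is proportional to the sum of all basis vectors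
  with an even number of up spins, so that \<open>P + Q\<close>, and hence \<open>Q\<close>, does not vanish.
\<close>

section \<open>Spin flips, translations and sums over configurations\<close>

text \<open>The Pauli matrix \<open>pauli_x\<close> at site \<open>j\<close>, read as a permutation
  of configurations. An update beyond the end of a list changes nothing, so \<open>flip j\<close> is
  an involution without any bound on \<open>j\<close>.\<close>

definition flip :: "nat \<Rightarrow> bool list \<Rightarrow> bool list" where
  "flip j \<mu> = \<mu>[j := \<not> \<mu> ! j]"

lemma length_flip [simp]: "length (flip j \<mu>) = length \<mu>"
  by (simp add: flip_def)

lemma nth_flip_other [simp]: "i \<noteq> j \<Longrightarrow> flip j \<mu> ! i = \<mu> ! i"
  by (simp add: flip_def)

lemma flip_flip [simp]: "flip j (flip j \<mu>) = \<mu>"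
  by (cases "j < length \<mu>") (simp_all add: flip_def not_less list_update_beyond)

lemma flip_commute: "flip i (flip j \<mu>) = flip j (flip i \<mu>)"
  by (cases "i = j") (simp_all add: flip_def list_update_swap)

lemma even_count_flip:
  "j < length \<mu> \<Longrightarrow> even (count_list (flip j \<mu>) True) \<longleftrightarrow> odd (count_list \<mu> True)"
proof (induction \<mu> arbitrary: j)
  case (Cons a \<mu>)
  then show ?case by (cases j) (auto simp: flip_def)
qed simp

lemma map_Not_flip: "j < length \<mu> \<Longrightarrow> map Not (flip j \<mu>) = flip j (map Not \<mu>)"
  by (simp add: flip_def map_update)

lemma even_count_map_Not:
  "odd (length \<mu>) \<Longrightarrow> even (count_list (map Not \<mu>) True) \<longleftrightarrow> odd (count_list \<mu> True)"
proof -
  have "count_list (map Not \<mu>) True + count_list \<mu> True = length \<mu>"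
    by (induction \<mu>) auto
  then show "odd (length \<mu>) \<Longrightarrow> ?thesis"
    by (metis even_add)
qed

lemma count_list_rotate1: "count_list (rotate1 \<mu>) x = count_list \<mu> x"
  by (cases \<mu>) auto

text \<open>\<open>rotate1\<close> carries the spin at the cyclic successor of \<open>j\<close> to
  position \<open>j\<close>.\<close>

lemma rotate1_flip:
  assumes "j < length \<mu>"
  shows "rotate1 (flip (Suc j mod length \<mu>) \<mu>) = flip j (rotate1 \<mu>)"
proof (rule nth_equalityI)
  fix i
  assume "i < length (rotate1 (flip (Suc j mod length \<mu>) \<mu>))"
  moreover have "Suc i mod n = Suc j mod n \<longleftrightarrow> i = j" if "i < n" "j < n" for i j n :: nat
    using that by (auto simp: mod_Suc split: if_splits)
  moreover have "Suc j mod length \<mu> < length \<mu>"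
    using assms by (intro mod_less_divisor) auto
  ultimately show "rotate1 (flip (Suc j mod length \<mu>) \<mu>) ! i = flip j (rotate1 \<mu>) ! i"
    using assms by (auto simp: flip_def nth_rotate1 nth_list_update)
qed simp

lemma finite_configurations [simp]: "finite {\<mu> :: bool list. length \<mu> = n}"
  using finite_lists_length_eq[of "UNIV :: bool set" n] by simp

lemma sum_configurations_Suc:
  "(\<Sum>\<mu> | length \<mu> = Suc n. f \<mu>) = (\<Sum>m\<in>UNIV. \<Sum>\<nu> | length \<nu> = n. f (m # \<nu>))"
  for f :: "bool list \<Rightarrow> 'a :: comm_monoid_add"
proof -
  have "(\<Sum>m\<in>UNIV. \<Sum>\<nu> | length \<nu> = n. f (m # \<nu>)) =
      (\<Sum>(m, \<nu>)\<in>UNIV \<times> {\<nu>. length \<nu> = n}. f (m # \<nu>))"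
    by (rule sum.cartesian_product)
  also have "\<dots> = (\<Sum>\<mu> | length \<mu> = Suc n. f \<mu>)"
    by (rule sum.reindex_bij_witness[where i = "\<lambda>\<mu>. (hd \<mu>, tl \<mu>)" and j = "\<lambda>(m, \<nu>). m # \<nu>"])
      (auto simp: length_Suc_conv)
  finally show ?thesis by simp
qed

lemma sum_configurations_flip:
  "(\<Sum>\<mu> | length \<mu> = n. f (flip j \<mu>)) = (\<Sum>\<mu> | length \<mu> = n. f \<mu>)"
  by (rule sum.reindex_bij_witness[where i = "flip j" and j = "flip j"]) auto

lemma sum_configurations_rotate1:
  "(\<Sum>\<mu> | length \<mu> = n. f (rotate1 \<mu>)) = (\<Sum>\<mu> | length \<mu> = n. f \<mu>)"
proof (rule sum.reindex_bij_betw)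
  have "rotate1 ` {\<mu> :: 'b list. length \<mu> = n} = {\<mu>. length \<mu> = n}"
  proof safe
    fix \<mu> :: "'b list"
    assume "n = length \<mu>"
    \<comment> \<open>The preimage is \<open>\<mu>\<close> rotated by
      \<open>length \<mu> - 1\<close> steps: one more step completes a full turn.\<close>
    then have "\<mu> = rotate1 (rotate (length \<mu> - 1) \<mu>)"
      by (metis One_nat_def Suc_pred length_greater_0_conv rotate1.simps(1) rotate_Suc
          rotate_is_Nil_conv rotate_length01 rotate_id mod_self)
    then show "\<mu> \<in> rotate1 ` {\<mu>'. length \<mu>' = length \<mu>}"
      by (metis (mono_tags) imageI length_rotate mem_Collect_eq)
  qed simp
  then show "bij_betw rotate1 {\<mu> :: 'b list. length \<mu> = n} {\<mu>. length \<mu> = n}"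
    by (simp add: bij_betw_def inj_rotate1 inj_on_subset[OF inj_rotate1])
qed

section \<open>The Hamiltonian in components and its symmetries\<close>

text \<open>The x and y terms both flip the two spins of a bond. The y term carries the sign -1 if
  the spins agree and 1 otherwise, so the coefficients 1 + \<alpha> and 1 - \<alpha> combine to 2
  \<alpha> or to 2. The bound on \<open>N\<close> makes the two sites of a bond distinct.\<close>

lemma xyz_hamiltonian_eq:
  assumes "2 \<le> N"
  shows "xyz_hamiltonian N \<alpha> \<psi> \<mu> = - (1 / 2) * (\<Sum>j<N. let j' = Suc j mod N in
     (if \<mu> ! j = \<mu> ! j' then of_real (2 * \<alpha>) else 2) * \<psi> (flip j (flip j' \<mu>))
     + (if \<mu> ! j = \<mu> ! j' then 1 else - 1) * of_real ((\<alpha>\<^sup>2 - 1) / 2) * \<psi> \<mu>)"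
proof -
  have ne: "Suc j mod N \<noteq> j" if "j < N" for j
    using that assms by (auto simp: mod_Suc)
  have x: "one_site_op pauli_x j \<phi> \<nu> = \<phi> (flip j \<nu>)" for j \<phi> \<nu>
    by (cases "\<nu> ! j") (simp_all add: one_site_op_def pauli_x_def UNIV_bool flip_def)
  have y: "one_site_op pauli_y j \<phi> \<nu> = (if \<nu> ! j then - \<i> else \<i>) * \<phi> (flip j \<nu>)" for j \<phi> \<nu>
    by (cases "\<nu> ! j") (simp_all add: one_site_op_def pauli_y_def UNIV_bool flip_def)
  have z: "one_site_op pauli_z j \<phi> \<nu> = (if \<nu> ! j then 1 else - 1) * \<phi> \<nu>" for j \<phi> \<nu>
    using list_update_id[of \<nu> j]
    by (cases "\<nu> ! j") (simp_all add: one_site_op_def pauli_z_def UNIV_bool)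
  show ?thesis
    unfolding xyz_hamiltonian_def x y z Let_def
    by (intro arg_cong[where f = "(*) (- (1 / 2))"] sum.cong refl)
      (use ne in \<open>auto simp: flip_commute algebra_simps\<close>)
qed

lemma xyz_hamiltonian_state_space:
  assumes "\<psi> \<in> state_space N" "length \<mu> \<noteq> N"
  shows "xyz_hamiltonian N \<alpha> \<psi> \<mu> = 0"
  using assms by (simp add: xyz_hamiltonian_def one_site_op_def state_space_def)

lemma xyz_eigenspaceI:
  assumes "\<psi> \<in> state_space N"
    and "\<And>\<mu>. length \<mu> = N \<Longrightarrow> xyz_hamiltonian N \<alpha> \<psi> \<mu> = E * \<psi> \<mu>"
  shows "\<psi> \<in> xyz_eigenspace N \<alpha> E"
proof -
  have "xyz_hamiltonian N \<alpha> \<psi> \<mu> = E * \<psi> \<mu>" for \<mu>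
    using assms xyz_hamiltonian_state_space[OF assms(1), of \<mu>]
    by (cases "length \<mu> = N") (auto simp: state_space_def)
  then show ?thesis using assms(1) by (auto simp: xyz_eigenspace_def)
qed

lemma xyz_eigenspaceD:
  assumes "\<psi> \<in> xyz_eigenspace N \<alpha> E"
  shows "\<psi> \<in> state_space N" "xyz_hamiltonian N \<alpha> \<psi> \<mu> = E * \<psi> \<mu>"
  using assms by (auto simp: xyz_eigenspace_def)

text \<open>The coefficients depend only on whether neighbouring spins agree, which reversing all
  spins preserves.\<close>

lemma spin_flip_eigenspace:
  assumes "2 \<le> N" "\<psi> \<in> xyz_eigenspace N \<alpha> E"
  shows "(\<lambda>\<mu>. \<psi> (map Not \<mu>)) \<in> xyz_eigenspace N \<alpha> E"
proof (rule xyz_eigenspaceI)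
  show "(\<lambda>\<mu>. \<psi> (map Not \<mu>)) \<in> state_space N"
    using xyz_eigenspaceD(1)[OF assms(2)] by (auto simp: state_space_def)
  fix \<mu> :: "bool list"
  assume len: "length \<mu> = N"
  then have "xyz_hamiltonian N \<alpha> (\<lambda>\<mu>. \<psi> (map Not \<mu>)) \<mu> = xyz_hamiltonian N \<alpha> \<psi> (map Not \<mu>)"
    unfolding xyz_hamiltonian_eq[OF assms(1)] Let_def
    by (intro arg_cong[where f = "(*) (- (1 / 2))"] sum.cong refl) (auto simp: map_Not_flip)
  then show "xyz_hamiltonian N \<alpha> (\<lambda>\<mu>. \<psi> (map Not \<mu>)) \<mu> = E * \<psi> (map Not \<mu>)"
    by (simp add: xyz_eigenspaceD(2)[OF assms(2)])
qed

lemma sum_cyclic_shift: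
  "(\<Sum>j<n. f (Suc j mod n)) = (\<Sum>j<n. f j)" for f :: "nat \<Rightarrow> 'a :: comm_monoid_add"
proof (cases n)
  case (Suc m)
  have "(\<Sum>j<Suc m. f (Suc j mod Suc m)) = (\<Sum>j<m. f (Suc j mod Suc m)) + f 0"
    by simp
  also have "(\<Sum>j<m. f (Suc j mod Suc m)) = (\<Sum>j<m. f (Suc j))"
    by (intro sum.cong) auto
  also have "\<dots> + f 0 = (\<Sum>j<Suc m. f j)"
    by (subst sum.lessThan_Suc_shift) (simp add: add.commute)
  finally show ?thesis by (simp only: Suc)
qed simp

lemma translation_eigenspace:
  assumes "2 \<le> N" "\<psi> \<in> xyz_eigenspace N \<alpha> E"
  shows "(\<lambda>\<mu>. \<psi> (rotate1 \<mu>)) \<in> xyz_eigenspace N \<alpha> E"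
proof (rule xyz_eigenspaceI)
  show "(\<lambda>\<mu>. \<psi> (rotate1 \<mu>)) \<in> state_space N"
    using xyz_eigenspaceD(1)[OF assms(2)] by (auto simp: state_space_def)
  fix \<mu> :: "bool list"
  assume len: "length \<mu> = N"
  \<comment> \<open>\<open>g j\<close> is the term of bond \<open>j\<close> for the translated state
    at \<open>\<mu>\<close>. Bond \<open>j\<close> of \<open>rotate1 \<mu>\<close> is the cyclically
    next bond of \<open>\<mu>\<close>, so translation only permutes the terms.\<close>
  define g where "g = (\<lambda>j. let j' = Suc j mod N in
     (if \<mu> ! j = \<mu> ! j' then of_real (2 * \<alpha>) else 2) * \<psi> (rotate1 (flip j (flip j' \<mu>)))
     + (if \<mu> ! j = \<mu> ! j' then 1 else - 1) * of_real ((\<alpha>\<^sup>2 - 1) / 2) * \<psi> (rotate1 \<mu>))"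
  have nth: "rotate1 \<mu> ! j = \<mu> ! (Suc j mod N)" if "j < N" for j
    using that len by (simp add: nth_rotate1)
  have fl: "flip j (rotate1 \<nu>) = rotate1 (flip (Suc j mod N) \<nu>)" if "j < N" "length \<nu> = N" for j \<nu>
    using that rotate1_flip by metis
  have "xyz_hamiltonian N \<alpha> \<psi> (rotate1 \<mu>) = - (1 / 2) * (\<Sum>j<N. g (Suc j mod N))"
    unfolding xyz_hamiltonian_eq[OF assms(1)] Let_def g_def
    by (intro arg_cong[where f = "(*) (- (1 / 2))"] sum.cong refl) (simp add: nth fl len)
  also have "(\<Sum>j<N. g (Suc j mod N)) = (\<Sum>j<N. g j)"
    by (rule sum_cyclic_shift)
  also have "- (1 / 2) * \<dots> = xyz_hamiltonian N \<alpha> (\<lambda>\<mu>. \<psi> (rotate1 \<mu>)) \<mu>"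
    unfolding xyz_hamiltonian_eq[OF assms(1)] g_def ..
  finally show "xyz_hamiltonian N \<alpha> (\<lambda>\<mu>. \<psi> (rotate1 \<mu>)) \<mu> = E * \<psi> (rotate1 \<mu>)"
    by (simp add: xyz_eigenspaceD(2)[OF assms(2)])
qed

section \<open>Uniqueness of the eigenvector in the even sector\<close>

definition even_sector :: "state set" where
  "even_sector = {\<psi>. \<forall>\<mu>. odd (count_list \<mu> True) \<longrightarrow> \<psi> \<mu> = 0}"

text \<open>For odd \<open>N\<close> the spin-flipped vector \<open>\<phi>'\<close> has a nonzero
  component with an odd number of up spins, so it lies outside the span of \<open>\<phi>\<close> and
  \<open>\<xi>\<close>. If \<open>\<xi>\<close> were not a multiple of \<open>\<phi>\<close>, three
  independent vectors would lie in a space of dimension 2.\<close>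

lemma even_eigenvector_unique:
  assumes "2 \<le> N" "odd N"
    and dim: "state.dim (xyz_eigenspace N \<alpha> E) = 2"
    and \<phi>: "\<phi> \<in> xyz_eigenspace N \<alpha> E" "\<phi> \<in> even_sector" "\<phi> \<noteq> 0"
    and \<xi>: "\<xi> \<in> xyz_eigenspace N \<alpha> E" "\<xi> \<in> even_sector"
  obtains c where "\<xi> = (\<lambda>\<mu>. c * \<phi> \<mu>)"
proof -
  define \<phi>' where "\<phi>' = (\<lambda>\<mu>. \<phi> (map Not \<mu>))"
  have \<phi>': "\<phi>' \<in> xyz_eigenspace N \<alpha> E"
    unfolding \<phi>'_def using assms(1) \<phi>(1) by (rule spin_flip_eigenspace)
  obtain \<mu> where \<mu>: "\<phi> \<mu> \<noteq> 0"
    using \<phi>(3) by (auto simp: fun_eq_iff)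
  then have "length \<mu> = N" "even (count_list \<mu> True)"
    using xyz_eigenspaceD(1)[OF \<phi>(1)] \<phi>(2) by (auto simp: state_space_def even_sector_def)
  then have "odd (count_list (map Not \<mu>) True)" "\<phi>' (map Not \<mu>) \<noteq> 0"
    using even_count_map_Not[of \<mu>] \<mu> \<open>odd N\<close> by (simp_all add: \<phi>'_def o_def)
  then have "\<phi>' \<notin> even_sector"
    by (auto simp: even_sector_def)
  moreover have "state.subspace even_sector"
    by (auto simp: state.subspace_def even_sector_def)
  ultimately have "\<phi>' \<notin> state.span {\<phi>, \<xi>}"
    using \<phi>(2) \<xi>(2) state.span_minimal[of "{\<phi>, \<xi>}" even_sector] by blast
  have "\<xi> \<in> state.span {\<phi>}"
  proof (rule ccontr)
    assume \<xi>_notin: "\<xi> \<notin> state.span {\<phi>}"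
    have "state.independent {\<phi>}"
      using \<phi>(3) state.independent_insert[of \<phi> "{}"] by simp
    then have "state.independent {\<xi>, \<phi>}"
      using \<xi>_notin state.independent_insert[of \<xi> "{\<phi>}"] by (auto split: if_splits)
    then have indep: "state.independent {\<phi>', \<xi>, \<phi>}"
      using \<open>\<phi>' \<notin> state.span {\<phi>, \<xi>}\<close> state.independent_insert[of \<phi>' "{\<xi>, \<phi>}"]
      by (auto simp: insert_commute split: if_splits)
    have "\<xi> \<noteq> \<phi>" "\<phi>' \<noteq> \<xi>" "\<phi>' \<noteq> \<phi>"
      using \<xi>_notin \<open>\<phi>' \<notin> state.span {\<phi>, \<xi>}\<close> by (auto intro: state.span_base)
    then have "card {\<phi>', \<xi>, \<phi>} = 3" by simp
    \<comment> \<open>The equation \<open>card B = 2\<close> also gives the finiteness of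
      \<open>B\<close> that the bound on independent sets requires.\<close>
    moreover obtain B where "xyz_eigenspace N \<alpha> E \<subseteq> state.span B" "card B = 2"
      using state.basis_exists[of "xyz_eigenspace N \<alpha> E"] dim by metis
    ultimately show False
      using state.independent_span_bound[OF _ indep, of B] \<phi>(1) \<phi>' \<xi>(1)
      by (auto simp: card_ge_0_finite subset_iff)
  qed
  then show thesis
    using that by (auto simp: state.span_singleton)
qed

section \<open>The eigenvalue equation summed over all configurations\<close>

text \<open>The factor \<alpha> - 1 stays because the summed equation is trivial at \<alpha> = 1; it
  can be cancelled only between polynomials.\<close>

lemma translation_invariant_sum_ratio:
  assumes N: "2 \<le> N"
    and \<psi>: "\<psi> \<in> xyz_eigenspace N \<alpha> (of_real (ground_energy N \<alpha>))"
    and inv: "\<And>\<mu>. \<psi> (rotate1 \<mu>) = \<psi> \<mu>"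
  shows "(of_real \<alpha> - 1) * ((of_real \<alpha> + 1) * (\<Sum>\<mu> | length \<mu> = N. if \<mu> ! 0 = \<mu> ! 1 then 0 else \<psi> \<mu>)
     - 2 * (\<Sum>\<mu> | length \<mu> = N. if \<mu> ! 0 = \<mu> ! 1 then \<psi> \<mu> else 0)) = 0"
proof -
  define S where "S = (\<lambda>j. \<Sum>\<mu> | length \<mu> = N. if \<mu> ! j = \<mu> ! (Suc j mod N) then \<psi> \<mu> else 0)"
  define D where "D = (\<lambda>j. \<Sum>\<mu> | length \<mu> = N. if \<mu> ! j = \<mu> ! (Suc j mod N) then 0 else \<psi> \<mu>)"
  have shift: "S (Suc j) = S j" "D (Suc j) = D j" if "Suc j < N" for j
  proof -
    have nth: "rotate1 \<mu> ! j = \<mu> ! Suc j" "rotate1 \<mu> ! (Suc j mod N) = \<mu> ! (Suc (Suc j) mod N)"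
      if "length \<mu> = N" for \<mu> :: "bool list"
      using \<open>Suc j < N\<close> that by (simp_all add: nth_rotate1)
    show "S (Suc j) = S j"
      unfolding S_def
      by (subst (2) sum_configurations_rotate1[symmetric]) (intro sum.cong, auto simp: nth inv)
    show "D (Suc j) = D j"
      unfolding D_def
      by (subst (2) sum_configurations_rotate1[symmetric]) (intro sum.cong, auto simp: nth inv)
  qed
  have const: "S j = S 0 \<and> D j = D 0" if "j < N" for j
    using that by (induction j) (use shift in auto)
  have total: "S j + D j = (\<Sum>\<mu> | length \<mu> = N. \<psi> \<mu>)" for j
    unfolding S_def D_def sum.distrib[symmetric] by (intro sum.cong) auto
  \<comment> \<open>Flipping both ends of a bond preserves their agreement, so the coefficient may
    be taken at the flipped configuration and both flips removed by reindexing.\<close>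
  have bond: "(\<Sum>\<mu> | length \<mu> = N. let j' = Suc j mod N in
       (if \<mu> ! j = \<mu> ! j' then of_real (2 * \<alpha>) else 2) * \<psi> (flip j (flip j' \<mu>))
       + (if \<mu> ! j = \<mu> ! j' then 1 else - 1) * of_real ((\<alpha>\<^sup>2 - 1) / 2) * \<psi> \<mu>)
     = of_real (2 * \<alpha> + (\<alpha>\<^sup>2 - 1) / 2) * S 0 + of_real (2 - (\<alpha>\<^sup>2 - 1) / 2) * D 0"
    (is "(\<Sum>\<mu> | _. let j' = _ in ?c \<mu> j' * _ + ?d \<mu> j' * _ * _) = _") if "j < N" for j
  proof -
    let ?j' = "Suc j mod N"
    have ne: "?j' \<noteq> j"
      using that N by (auto simp: mod_Suc)
    have "(flip j (flip ?j' \<mu>) ! j = flip j (flip ?j' \<mu>) ! ?j') = (\<mu> ! j = \<mu> ! ?j')"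
      if "length \<mu> = N" for \<mu>
      using ne that \<open>j < N\<close> by (auto simp: flip_def nth_list_update)
    then have "(\<Sum>\<mu> | length \<mu> = N. ?c \<mu> ?j' * \<psi> (flip j (flip ?j' \<mu>)))
       = (\<Sum>\<mu> | length \<mu> = N. ?c (flip j (flip ?j' \<mu>)) ?j' * \<psi> (flip j (flip ?j' \<mu>)))"
      by (intro sum.cong) auto
    also have "\<dots> = (\<Sum>\<mu> | length \<mu> = N. ?c \<mu> ?j' * \<psi> \<mu>)"
      using sum_configurations_flip[of "\<lambda>\<mu>. ?c (flip j \<mu>) ?j' * \<psi> (flip j \<mu>)" ?j']
        sum_configurations_flip[of "\<lambda>\<mu>. ?c \<mu> ?j' * \<psi> \<mu>" j] by simp
    finally have "(\<Sum>\<mu> | length \<mu> = N. ?c \<mu> ?j' * \<psi> (flip j (flip ?j' \<mu>))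
         + ?d \<mu> ?j' * of_real ((\<alpha>\<^sup>2 - 1) / 2) * \<psi> \<mu>)
       = (\<Sum>\<mu> | length \<mu> = N. ?c \<mu> ?j' * \<psi> \<mu> + ?d \<mu> ?j' * of_real ((\<alpha>\<^sup>2 - 1) / 2) * \<psi> \<mu>)"
      by (simp only: sum.distrib)
    also have "\<dots> = of_real (2 * \<alpha> + (\<alpha>\<^sup>2 - 1) / 2) * S j + of_real (2 - (\<alpha>\<^sup>2 - 1) / 2) * D j"
      unfolding S_def D_def sum_distrib_left sum.distrib[symmetric]
      by (intro sum.cong) (auto simp: field_simps)
    finally show ?thesis
      using const[OF that] by (simp add: Let_def)
  qed
  have "of_real (ground_energy N \<alpha>) * (S 0 + D 0) = (\<Sum>\<mu> | length \<mu> = N. xyz_hamiltonian N \<alpha> \<psi> \<mu>)"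
    by (simp add: total sum_distrib_left xyz_eigenspaceD(2)[OF \<psi>])
  also have "\<dots> = - (1 / 2) * of_nat N *
      (of_real (2 * \<alpha> + (\<alpha>\<^sup>2 - 1) / 2) * S 0 + of_real (2 - (\<alpha>\<^sup>2 - 1) / 2) * D 0)"
    unfolding xyz_hamiltonian_eq[OF N] sum_distrib_left[symmetric]
    by (subst sum.swap, subst sum.cong[OF refl bond])
      (simp_all only: lessThan_iff sum_constant card_lessThan mult.assoc)
  finally have energy: "of_real (ground_energy N \<alpha>) * (S 0 + D 0) = - (1 / 2) * of_nat N *
      (of_real (2 * \<alpha> + (\<alpha>\<^sup>2 - 1) / 2) * S 0 + of_real (2 - (\<alpha>\<^sup>2 - 1) / 2) * D 0)" .
  \<comment> \<open>Per bond, subtracting (3 + \<alpha> \<alpha>) / 2, which comes from the energy,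
    leaves 2 (\<alpha> - 1) for \<open>S 0\<close> and 1 - \<alpha> \<alpha> for \<open>D 0\<close>;
    both contain \<alpha> - 1.\<close>
  have "of_nat N * ((of_real \<alpha> - 1) * ((of_real \<alpha> + 1) * D 0 - 2 * S 0)) =
      2 * (- (1 / 2) * of_nat N *
      (of_real (2 * \<alpha> + (\<alpha>\<^sup>2 - 1) / 2) * S 0 + of_real (2 - (\<alpha>\<^sup>2 - 1) / 2) * D 0)
      - of_real (ground_energy N \<alpha>) * (S 0 + D 0))"
    by (simp add: ground_energy_def field_simps power2_eq_square)
  also have "\<dots> = 0"
    by (simp only: energy) simp
  finally have "of_nat N * ((of_real \<alpha> - 1) * ((of_real \<alpha> + 1) * D 0 - 2 * S 0)) = 0" .
  then show ?thesis
    using N by (simp add: S_def D_def)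
qed

section \<open>From integer values of \<alpha> to a polynomial identity\<close>

text \<open>Integer points suffice below, since a polynomial vanishing at all of them is zero, and
  there the components are integers.\<close>

lemma eval_state_of_int: "eval_state \<Psi> (of_int a) \<mu> = of_int (poly (\<Psi> \<mu>) a)"
proof -
  have "poly (map_poly of_int p) (of_int a) = (of_int (poly p a) :: complex)" for p
    by (induction p) (simp_all add: map_poly_pCons)
  then show ?thesis by (simp add: eval_state_def)
qed

lemma Xi_sums:
  assumes "2 \<le> N"
  shows "of_int (poly (Xi_numerator N \<Psi>) a) =
      (\<Sum>\<mu> | length \<mu> = N. if \<mu> ! 0 = \<mu> ! 1 then 0 else eval_state \<Psi> (of_int a) \<mu>)"
    and "of_int (poly (Xi_denominator N \<Psi>) a) =
      (\<Sum>\<mu> | length \<mu> = N. if \<mu> ! 0 = \<mu> ! 1 then eval_state \<Psi> (of_int a) \<mu> else 0)"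
proof -
  obtain n where n: "N = Suc (Suc n)"
    using assms by (metis add_2_eq_Suc le_Suc_ex)
  show "of_int (poly (Xi_numerator N \<Psi>) a) =
      (\<Sum>\<mu> | length \<mu> = N. if \<mu> ! 0 = \<mu> ! 1 then 0 else eval_state \<Psi> (of_int a) \<mu>)"
    unfolding n sum_configurations_Suc
    by (simp add: Xi_numerator_def poly_sum UNIV_bool eval_state_of_int)
  show "of_int (poly (Xi_denominator N \<Psi>) a) =
      (\<Sum>\<mu> | length \<mu> = N. if \<mu> ! 0 = \<mu> ! 1 then eval_state \<Psi> (of_int a) \<mu> else 0)"
    unfolding n sum_configurations_Suc
    by (simp add: Xi_denominator_def poly_sum UNIV_bool eval_state_of_int)
qed

theorem corollary6p1:
  fixes N :: nat and \<rho> :: complex and \<Psi> :: "bool list \<Rightarrow> int poly"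
  assumes "3 \<le> N" and "odd N" and "\<rho> \<noteq> 0"
    and "hypothesis_A N"
    and "polynomial_ground_state N \<Psi>"
    and "hypothesis_B N \<Psi>"
    and "hypothesis_C N \<rho>"
  shows "Xi_denominator N \<Psi> \<noteq> 0 \<and> Xi N \<Psi> = Fract 2 [:1, 1:]"
proof -
  let ?num = "Xi_numerator N \<Psi>" and ?den = "Xi_denominator N \<Psi>"
  let ?down = "replicate N False"
  have N: "2 \<le> N" using assms(1) by simp
  have eigen: "eval_state \<Psi> \<alpha> \<in> xyz_eigenspace N \<alpha> (of_real (ground_energy N \<alpha>))" for \<alpha>
    using assms(5) by (simp add: polynomial_ground_state_def)
  have even: "eval_state \<Psi> \<alpha> \<in> even_sector" for \<alpha>
    using assms(5) by (auto simp: polynomial_ground_state_def even_sector_def eval_state_def)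
  have dim: "state.dim (xyz_eigenspace N \<alpha> (of_real (ground_energy N \<alpha>))) = 2" for \<alpha>
    using assms(4) by (auto simp: hypothesis_A_def)
  note unique = even_eigenvector_unique[OF N assms(2) dim eigen even]
  \<comment> \<open>The factor \<open>\<Psi> ?down\<close> makes the claim trivial at the points
    where this component vanishes and the translation eigenvalue could not be read off from
    it.\<close>
  have "poly ([:- 1, 1:] * \<Psi> ?down * ([:1, 1:] * ?num - 2 * ?den)) a = 0" for a
  proof (cases "poly (\<Psi> ?down) a = 0")
    case False
    let ?\<psi> = "eval_state \<Psi> (of_int a)"
    have down: "?\<psi> ?down \<noteq> 0"
      using False by (simp add: eval_state_of_int)
    then have "?\<psi> \<noteq> 0" by (metis zero_fun_apply)
    moreover have "(\<lambda>\<mu>. ?\<psi> (rotate1 \<mu>)) \<in> even_sector"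
      using even[of "of_int a"] by (simp add: even_sector_def count_list_rotate1)
    ultimately obtain c where c: "(\<lambda>\<mu>. ?\<psi> (rotate1 \<mu>)) = (\<lambda>\<mu>. c * ?\<psi> \<mu>)"
      using unique translation_eigenspace[OF N eigen] by blast
    have "rotate1 ?down = ?down"
      by (cases N) (simp_all add: replicate_append_same)
    then have "c = 1"
      using fun_cong[OF c, of ?down] down by simp
    then have invariant: "\<And>\<mu>. ?\<psi> (rotate1 \<mu>) = ?\<psi> \<mu>"
      using c by (simp add: fun_eq_iff)
    have "of_int ((a - 1) * ((a + 1) * poly ?num a - 2 * poly ?den a)) = (0 :: complex)"
      using translation_invariant_sum_ratio[OF N eigen invariant]
      unfolding Xi_sums[OF N, symmetric] by simp
    then have "(a - 1) * ((a + 1) * poly ?num a - 2 * poly ?den a) = 0"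
      by (simp only: of_int_eq_0_iff)
    moreover have "poly ([:- 1, 1:] * \<Psi> ?down * ([:1, 1:] * ?num - 2 * ?den)) a
       = poly (\<Psi> ?down) a * ((a - 1) * ((a + 1) * poly ?num a - 2 * poly ?den a))"
      by (simp add: algebra_simps)
    ultimately show ?thesis by simp
  qed simp
  then have "[:- 1, 1:] * \<Psi> ?down * ([:1, 1:] * ?num - 2 * ?den) = 0"
    using poly_all_0_iff_0 by blast
  moreover have "\<Psi> ?down \<noteq> 0"
    using assms(6) by (auto simp: hypothesis_B_def)
  ultimately have identity: "[:1, 1:] * ?num = 2 * ?den"
    unfolding mult_eq_0_iff by simp
  \<comment> \<open>At \<alpha> = 1 the z term drops out and every bond becomes twice a double flip,
    which fixes \<open>e\<close>; hence the energy -N.\<close>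
  define e :: state where "e = (\<lambda>\<mu>. if length \<mu> = N \<and> even (count_list \<mu> True) then 1 else 0)"
  have "e \<in> xyz_eigenspace N 1 (of_real (ground_energy N 1))"
  proof (rule xyz_eigenspaceI)
    fix \<mu> :: "bool list"
    assume len: "length \<mu> = N"
    then have "e (flip i (flip j \<mu>)) = e \<mu>" if "i < N" "j < N" for i j
      using that by (simp add: e_def even_count_flip)
    moreover have "Suc j mod N < N" for j
      using N by simp
    ultimately show "xyz_hamiltonian N 1 e \<mu> = of_real (ground_energy N 1) * e \<mu>"
      by (simp add: xyz_hamiltonian_eq[OF N] ground_energy_def cong: if_cong)
  qed (auto simp: e_def state_space_def)
  \<comment> \<open>Otherwise \<alpha> - 1 would be a non-constant common factor of all
    components.\<close>
  moreover have "eval_state \<Psi> 1 \<noteq> 0"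
  proof
    assume "eval_state \<Psi> 1 = 0"
    then have "poly (\<Psi> \<mu>) 1 = 0" for \<mu>
      using eval_state_of_int[of \<Psi> 1 \<mu>] by simp
    then have "\<forall>\<mu>. [:- 1, 1:] dvd \<Psi> \<mu>"
      by (simp add: poly_eq_0_iff_dvd)
    then have "degree [:- 1, 1 :: int:] = 0"
      using assms(5) unfolding polynomial_ground_state_def by blast
    then show False by simp
  qed
  moreover have "e \<in> even_sector"
    by (simp add: e_def even_sector_def)
  ultimately obtain c where c: "e = (\<lambda>\<mu>. c * eval_state \<Psi> 1 \<mu>)"
    using unique by blast
  \<comment> \<open>If it vanished, so would the numerator by \<open>identity\<close>, and with them
    the component sum of \<open>e\<close>. That sum counts the even configurations, among them
    \<open>?down\<close>.\<close>
  have "?den \<noteq> 0"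
  proof
    assume "?den = 0"
    then have "[:1, 1:] * ?num = 0"
      using identity by (simp only: mult_zero_right)
    then have "?num = 0"
      unfolding mult_eq_0_iff by simp
    have "(\<Sum>\<mu> | length \<mu> = N. eval_state \<Psi> 1 \<mu>) = of_int (poly ?num 1) + of_int (poly ?den 1)"
      unfolding Xi_sums[OF N] sum.distrib[symmetric] by (intro sum.cong) auto
    then have "(\<Sum>\<mu> | length \<mu> = N. e \<mu>) = 0"
      by (simp add: c \<open>?num = 0\<close> \<open>?den = 0\<close> flip: sum_distrib_left)
    then have "card {\<mu> :: bool list. length \<mu> = N \<and> even (count_list \<mu> True)} = 0"
      by (simp add: e_def sum.If_cases Int_def)
    moreover have "?down \<in> {\<mu>. length \<mu> = N \<and> even (count_list \<mu> True)}"
      by (simp add: count_list_0_iff)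
    ultimately show False
      by (metis (no_types, lifting) card_0_eq empty_iff finite_configurations finite_subset mem_Collect_eq subsetI)
  qed
  then show ?thesis
    using identity by (simp add: Xi_def eq_fract mult.commute)
qed

end
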